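(* There is no tall Borel ideal on $\omega$ that is minimal, with respect to the Katětov order $\le_K$, among all tall Borel ideals on $\omega$.
   Context: An ideal on $\omega$ is a family $\mathcal{I}\subseteq\mathcal{P}(\omega)$ closed under subsets and finite unions and containing all finite subsets of $\omega$. It is Borel if it is a Borel subset of $\mathcal{P}(\omega)$, where $\mathcal{P}(\omega)$ is identified with the Cantor space $2^\omega$ via characteristic functions. An ideal $\mathcal{J}$ on $\omega$ is tall if for every infinite $A\subseteq\omega$ there is an infinite $B\in\mathcal{J}$ with $B\subseteq A$. For ideals $\mathcal{I},\mathcal{J}$ on $\omega$, $\mathcal{I}\le_K\mathcal{J}$ (Katětov order, a preorder) means that there is a function $f:\omega\to\omega$ such that $f^{-1}[I]\in\mathcal{J}$ for all $I\in\mathcal{I}$. A tall Borel ideal $\mathcal{J}$ is minimal if for every tall Borel ideal $\mathcal{I}$ with $\mathcal{I}\le_K\mathcal{J}$ one also has $\mathcal{J}\le_K\mathcal{I}$. *)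

theory Defs
  imports "HOL-Analysis.Analysis"
begin

text \<open>Ideals on \<open>\<omega>\<close> are not required to be proper: the improper ideal \<open>UNIV\<close> is allowed.\<close>

definition ideal_on_omega :: "nat set set \<Rightarrow> bool" where
  "ideal_on_omega \<I> \<longleftrightarrow>
     (\<forall>A B. A \<in> \<I> \<longrightarrow> B \<subseteq> A \<longrightarrow> B \<in> \<I>) \<and>
     (\<forall>A B. A \<in> \<I> \<longrightarrow> B \<in> \<I> \<longrightarrow> A \<union> B \<in> \<I>) \<and>
     (\<forall>A. finite A \<longrightarrow> A \<in> \<I>)"

definition char_fun :: "nat set \<Rightarrow> nat \<Rightarrow> bool" where
  "char_fun A = (\<lambda>n. n \<in> A)"

text \<open>The topology of \<^typ>\<open>nat \<Rightarrow> bool\<close> is the product topology with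
  discrete factors, i.e. that of the Cantor space.\<close>

definition borel_family :: "nat set set \<Rightarrow> bool" where
  "borel_family \<I> \<longleftrightarrow> char_fun ` \<I> \<in> sets borel"

definition tall :: "nat set set \<Rightarrow> bool" where
  "tall \<J> \<longleftrightarrow> (\<forall>A. infinite A \<longrightarrow> (\<exists>B\<in>\<J>. infinite B \<and> B \<subseteq> A))"

definition tall_borel_ideal :: "nat set set \<Rightarrow> bool" where
  "tall_borel_ideal \<J> \<longleftrightarrow> ideal_on_omega \<J> \<and> borel_family \<J> \<and> tall \<J>"

definition katetov_le :: "nat set set \<Rightarrow> nat set set \<Rightarrow> bool"  (infix "\<le>\<^sub>K" 50) where
  "\<I> \<le>\<^sub>K \<J> \<longleftrightarrow> (\<exists>f :: nat \<Rightarrow> nat. \<forall>I\<in>\<I>. f -` I \<in> \<J>)"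

definition minimal_tall_borel_ideal :: "nat set set \<Rightarrow> bool" where
  "minimal_tall_borel_ideal \<J> \<longleftrightarrow>
     tall_borel_ideal \<J> \<and> (\<forall>\<I>. tall_borel_ideal \<I> \<longrightarrow> \<I> \<le>\<^sub>K \<J> \<longrightarrow> \<J> \<le>\<^sub>K \<I>)"

end

theory Submission
  imports Defs "HOL-Library.Ramsey" "HOL-Library.Nat_Bijection"
begin

text \<open>
  Suppose that \<open>J\<close> is a minimal tall Borel ideal. Any two tall Borel ideals have a tall Borel
  lower bound in the Katetov order, their sum on two disjoint copies of \<open>\<omega>\<close>, so \<open>J\<close> is below
  every tall Borel ideal. The contradiction comes from a tall Borel ideal \<open>I\<close> with \<open>\<not> J \<le>\<^sub>K I\<close>.

  The reason that such an \<open>I\<close> exists is a gap in complexity. For ideals \<open>I\<close> that are generated by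
  closed families, tallness is as complicated as any \<open>\<Pi>\<^sup>1\<^sub>2\<close> property, while for a fixed tall Borel
  \<open>J\<close> the statement \<open>\<exists>f. \<forall>A\<in>J. f -` A \<in> I\<close> is only \<open>\<Sigma>\<^sup>1\<^sub>2\<close>; if \<open>J\<close> were a minimum, the two would
  be equivalent. Below, the diagonal argument behind this gap is unfolded into one construction,
  in which \<open>I\<close> refers to itself.

  The underlying set of \<open>I\<close> is the tree of finite sequences of naturals, so that the branches are
  exactly the functions \<open>f : \<omega> \<rightarrow> \<omega>\<close>, the candidates for witnessing \<open>J \<le>\<^sub>K I\<close>. Every infinite set of
  nodes contains an infinite antichain or an infinite subset of a branch
  (\<open>infinite_branch_or_antichain\<close>). Antichains are put into \<open>I\<close>. An infinite subset of the branch
  \<open>f\<close> is made a generator of \<open>I\<close> only if it is sparse enough to dominate a certificate that \<open>f\<close> does not witness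
  \<open>J \<le>\<^sub>K I\<close>, that is, that some \<open>A \<in> J\<close> has \<open>f -` A \<notin> I\<close>. Such certificates are sequences of naturals:
  a Borel set is the projection of a closed set, and non-membership in \<open>I\<close> is witnessed by a
  sequence of finite sets. Asking the set to dominate its certificate makes the condition closed
  and hereditary, and yet, as soon as one certificate exists, every infinite subset of the branch
  has an infinite subset that dominates it. Hence \<open>I\<close> contains an infinite subset of the branch \<open>f\<close> if
  and only if \<open>f\<close> does not witness \<open>J \<le>\<^sub>K I\<close>; the two directions are
  \<open>diag_ideal_branch_witness\<close>, which is a compactness argument, and \<open>diag_ideal_below_branch\<close>.

  Now \<open>f\<close> cannot witness \<open>J \<le>\<^sub>K I\<close>: tallness would pass from \<open>J\<close> to \<open>I\<close>, hence \<open>I\<close> would contain an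
  infinite subset of the branch \<open>f\<close>, hence \<open>f\<close> would not be a witness after all. So no \<open>f\<close> is a
  witness, therefore \<open>I\<close> has infinite members inside every branch, and \<open>I\<close> is tall.
\<close>

section \<open>Ideals, sums and the Katetov order\<close>

lemma ideal_on_omegaI:
  assumes "\<And>A B. A \<in> I \<Longrightarrow> B \<subseteq> A \<Longrightarrow> B \<in> I"
    and "\<And>A B. A \<in> I \<Longrightarrow> B \<in> I \<Longrightarrow> A \<union> B \<in> I"
    and "\<And>A. finite A \<Longrightarrow> A \<in> I"
  shows "ideal_on_omega I"
  unfolding ideal_on_omega_def using assms by (intro conjI allI impI)

lemma ideal_on_omegaD:
  assumes "ideal_on_omega I"
  shows "A \<in> I \<Longrightarrow> B \<subseteq> A \<Longrightarrow> B \<in> I"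
    and "A \<in> I \<Longrightarrow> B \<in> I \<Longrightarrow> A \<union> B \<in> I"
    and "finite A \<Longrightarrow> A \<in> I"
  using assms unfolding ideal_on_omega_def by blast+

lemma ideal_on_omega_vimage:
  assumes "ideal_on_omega I" "inj h"
  shows "ideal_on_omega {A. h -` A \<in> I}"
proof (rule ideal_on_omegaI; unfold mem_Collect_eq)
  show "h -` B \<in> I" if "h -` A \<in> I" "B \<subseteq> A" for A B
    using ideal_on_omegaD(1)[OF assms(1) that(1) vimage_mono[OF that(2)]] .
  show "h -` (A \<union> B) \<in> I" if "h -` A \<in> I" "h -` B \<in> I" for A B
    unfolding vimage_Un using ideal_on_omegaD(2)[OF assms(1) that] .
  show "h -` A \<in> I" if "finite A" for A
    using ideal_on_omegaD(3)[OF assms(1) finite_vimageI[OF that assms(2)]] .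
qed

lemma ideal_on_omega_Int:
  assumes "ideal_on_omega I" "ideal_on_omega J"
  shows "ideal_on_omega (I \<inter> J)"
proof (rule ideal_on_omegaI)
  show "B \<in> I \<inter> J" if "A \<in> I \<inter> J" "B \<subseteq> A" for A B
    using that ideal_on_omegaD(1)[OF assms(1), of A B] ideal_on_omegaD(1)[OF assms(2), of A B] by simp
  show "A \<union> B \<in> I \<inter> J" if "A \<in> I \<inter> J" "B \<in> I \<inter> J" for A B
    using that ideal_on_omegaD(2)[OF assms(1), of A B] ideal_on_omegaD(2)[OF assms(2), of A B] by simp
  show "A \<in> I \<inter> J" if "finite A" for A
    using that assms by (simp add: ideal_on_omegaD(3))
qed

lemma borel_family_iff: "borel_family I \<longleftrightarrow> {x. {n. x n} \<in> I} \<in> sets borel"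
proof -
  have "char_fun ` I = {x. {n. x n} \<in> I}"
    by (force simp: char_fun_def image_iff)
  then show ?thesis
    by (simp add: borel_family_def)
qed

lemma borel_family_vimage:
  assumes "borel_family I"
  shows "borel_family {A. h -` A \<in> I}"
proof -
  have "continuous_on UNIV (\<lambda>x :: nat \<Rightarrow> bool. \<lambda>n. x (h n))"
    by (intro continuous_on_coordinatewise_then_product continuous_on_product_coordinates)
  then have "(\<lambda>x :: nat \<Rightarrow> bool. \<lambda>n. x (h n)) \<in> borel \<rightarrow>\<^sub>M borel"
    by (rule borel_measurable_continuous_onI)
  then have "(\<lambda>x n. x (h n)) -` {x. {n. x n} \<in> I} \<inter> space borel \<in> sets borel"
    using assms by (intro measurable_sets) (simp_all add: borel_family_iff)
  then show ?thesis
    by (simp add: borel_family_iff vimage_def)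
qed

lemma borel_family_Int: "borel_family I \<Longrightarrow> borel_family J \<Longrightarrow> borel_family (I \<inter> J)"
  unfolding borel_family_iff by (simp add: Collect_conj_eq sets.Int)

text \<open>Two copies of \<open>\<omega>\<close>, the even and the odd numbers, carry \<open>I\<close> and \<open>J\<close>.\<close>

definition ideal_sum :: "nat set set \<Rightarrow> nat set set \<Rightarrow> nat set set" where
  "ideal_sum I J = {A. (*) 2 -` A \<in> I \<and> (\<lambda>n. 2 * n + 1) -` A \<in> J}"

text \<open>
  The inclusions of the two copies are the witnesses. This is why a minimal tall Borel ideal is
  below all others.
\<close>

lemma katetov_le_ideal_sum: "ideal_sum I J \<le>\<^sub>K I" "ideal_sum I J \<le>\<^sub>K J"
  unfolding katetov_le_def ideal_sum_def by blast+

lemma katetov_le_trans: "I \<le>\<^sub>K J \<Longrightarrow> J \<le>\<^sub>K K \<Longrightarrow> I \<le>\<^sub>K K"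
  unfolding katetov_le_def by (metis vimage_comp)

lemma tall_borel_ideal_sum:
  assumes "tall_borel_ideal I" "tall_borel_ideal J"
  shows "tall_borel_ideal (ideal_sum I J)"
proof -
  have sum_eq: "ideal_sum I J = {A. (*) 2 -` A \<in> I} \<inter> {A. (\<lambda>n. 2 * n + 1) -` A \<in> J}"
    by (auto simp: ideal_sum_def)
  have "ideal_on_omega (ideal_sum I J)"
    unfolding sum_eq using assms
    by (intro ideal_on_omega_Int ideal_on_omega_vimage injI) (auto simp: tall_borel_ideal_def)
  moreover have "borel_family (ideal_sum I J)"
    unfolding sum_eq using assms
    by (intro borel_family_Int borel_family_vimage) (auto simp: tall_borel_ideal_def)
  moreover have "tall (ideal_sum I J)"
    unfolding tall_def
  proof (intro allI impI)
    have empty: "{} \<in> I" "{} \<in> J" and "tall I" "tall J"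
      using assms by (simp_all add: tall_borel_ideal_def ideal_on_omegaD(3))
    fix X :: "nat set"
    assume "infinite X"
    have "X \<subseteq> (*) 2 ` ((*) 2 -` X) \<union> (\<lambda>n. 2 * n + 1) ` ((\<lambda>n. 2 * n + 1) -` X)"
    proof
      fix x assume "x \<in> X"
      then show "x \<in> (*) 2 ` ((*) 2 -` X) \<union> (\<lambda>n. 2 * n + 1) ` ((\<lambda>n. 2 * n + 1) -` X)"
        by (cases "even x") (blast elim: evenE, blast elim: oddE)
    qed
    then have "infinite ((*) 2 -` X) \<or> infinite ((\<lambda>n. 2 * n + 1) -` X)"
      using \<open>infinite X\<close> by (meson finite_UnI finite_imageI finite_subset)
    then show "\<exists>B\<in>ideal_sum I J. infinite B \<and> B \<subseteq> X"
    proof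
      assume "infinite ((*) 2 -` X)"
      then obtain B where B: "B \<in> I" "infinite B" "B \<subseteq> (*) 2 -` X"
        using \<open>tall I\<close> unfolding tall_def by blast
      have "(*) 2 -` ((*) 2 ` B) = B" "(\<lambda>n. 2 * n + 1) -` ((*) 2 ` B) = {}"
        by (auto dest: arg_cong[of _ _ even])
      then have "(*) 2 ` B \<in> ideal_sum I J"
        using B(1) empty by (simp add: ideal_sum_def)
      moreover have "infinite ((*) 2 ` B)"
        using B(2) by (simp add: finite_image_iff inj_on_def)
      ultimately show ?thesis
        using B(3) by blast
    next
      assume "infinite ((\<lambda>n. 2 * n + 1) -` X)"
      then obtain B where B: "B \<in> J" "infinite B" "B \<subseteq> (\<lambda>n. 2 * n + 1) -` X"
        using \<open>tall J\<close> unfolding tall_def by blast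
      have "(\<lambda>n. 2 * n + 1) -` ((\<lambda>n. 2 * n + 1) ` B) = B" "(*) 2 -` ((\<lambda>n. 2 * n + 1) ` B) = {}"
        by (auto dest: arg_cong[of _ _ even])
      then have "(\<lambda>n. 2 * n + 1) ` B \<in> ideal_sum I J"
        using B(1) empty by (simp add: ideal_sum_def)
      moreover have "infinite ((\<lambda>n. 2 * n + 1) ` B)"
        using B(2) by (simp add: finite_image_iff inj_on_def)
      ultimately show ?thesis
        using B(3) by blast
    qed
  qed
  ultimately show ?thesis
    by (simp add: tall_borel_ideal_def)
qed

text \<open>
  If \<open>f\<close> is constant on an infinite subset of \<open>X\<close>, that subset is in \<open>I\<close> because singletons are in
  \<open>J\<close>. Otherwise \<open>f ` X\<close> is infinite, and an infinite member of \<open>J\<close> inside it is pulled back.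
\<close>

lemma tall_if_katetov_above_tall:
  assumes "ideal_on_omega J" "tall J" "ideal_on_omega I" and f: "\<forall>A\<in>J. f -` A \<in> I"
  shows "tall I"
  unfolding tall_def
proof (intro allI impI)
  fix X :: "nat set"
  assume X: "infinite X"
  have *: "\<exists>B\<in>I. infinite B \<and> B \<subseteq> X" if A: "A \<in> J" "infinite (X \<inter> f -` A)" for A
    using A f ideal_on_omegaD(1)[OF assms(3)] by (meson Int_lower1 Int_lower2)
  show "\<exists>B\<in>I. infinite B \<and> B \<subseteq> X"
  proof (cases "finite (f ` X)")
    case True
    then obtain x where "infinite {y \<in> X. f y = f x}"
      using pigeonhole_infinite[OF X] by blast
    moreover have "X \<inter> f -` {f x} = {y \<in> X. f y = f x}"
      by auto
    ultimately show ?thesis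
      using *[of "{f x}"] ideal_on_omegaD(3)[OF assms(1)] by simp
  next
    case False
    then obtain A where A: "A \<in> J" "infinite A" "A \<subseteq> f ` X"
      using assms(2) unfolding tall_def by blast
    then have "A \<subseteq> f ` (X \<inter> f -` A)"
      by blast
    then have "infinite (X \<inter> f -` A)"
      using A(2) by (meson finite_imageI finite_subset)
    then show ?thesis
      using * A(1) by blast
  qed
qed

section \<open>Borel families as projections of closed sets\<close>

definition analytic :: "(nat \<Rightarrow> bool) set \<Rightarrow> bool" where
  "analytic X \<longleftrightarrow> (\<exists>Z :: ((nat \<Rightarrow> bool) \<times> (nat \<Rightarrow> nat)) set. closed Z \<and> X = fst ` Z)"

lemma analytic_closed:
  assumes "closed X"
  shows "analytic X"
proof -
  have "closed (X \<times> (UNIV :: (nat \<Rightarrow> nat) set))" and "X = fst ` (X \<times> (UNIV :: (nat \<Rightarrow> nat) set))"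
    using assms by (auto simp: closed_Times)
  then show ?thesis
    unfolding analytic_def by blast
qed

text \<open>
  A point of the union is certified by the index \<open>v 0\<close> of a member that contains it, followed by a
  certificate for that member.
\<close>

lemma analytic_UN:
  assumes "\<And>i::nat. analytic (X i)"
  shows "analytic (\<Union>i. X i)"
proof -
  obtain Z where cl: "\<And>i. closed (Z i)" and Z: "\<And>i. X i = fst ` (Z i :: ((nat \<Rightarrow> bool) \<times> (nat \<Rightarrow> nat)) set)"
    using assms unfolding analytic_def by metis
  define W where "W = (\<Inter>i. {(a, v). v 0 = i \<longrightarrow> (a, \<lambda>n. v (Suc n)) \<in> Z i})"
  have "closed {(a, v). v 0 = i \<longrightarrow> (a, \<lambda>n. v (Suc n)) \<in> Z i}" for i
  proof -
    have "continuous_on UNIV (\<lambda>p :: (nat \<Rightarrow> bool) \<times> (nat \<Rightarrow> nat). (fst p, \<lambda>n. snd p (Suc n)))"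
      by (intro continuous_intros continuous_on_product_then_coordinatewise)
    then have 1: "closed ((\<lambda>p. (fst p, \<lambda>n. snd p (Suc n))) -` Z i)"
      by (rule closed_vimage[OF cl])
    have "continuous_on UNIV (\<lambda>p :: (nat \<Rightarrow> bool) \<times> (nat \<Rightarrow> nat). snd p 0)"
      by (intro continuous_intros continuous_on_product_then_coordinatewise)
    then have 2: "closed ((\<lambda>p :: (nat \<Rightarrow> bool) \<times> (nat \<Rightarrow> nat). snd p 0) -` (- {i}))"
      by (rule closed_vimage[rotated]) (simp add: closed_def open_discrete)
    have "{(a, v). v 0 = i \<longrightarrow> (a, \<lambda>n. v (Suc n)) \<in> Z i}
      = ((\<lambda>p. (fst p, \<lambda>n. snd p (Suc n))) -` Z i) \<union> ((\<lambda>p. snd p 0) -` (- {i}))"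
      by auto
    then show ?thesis
      using closed_Un[OF 1 2] by simp
  qed
  then have "closed W"
    unfolding W_def by blast
  moreover have "(\<Union>i. X i) = fst ` W"
  proof (intro equalityI subsetI)
    fix a assume "a \<in> (\<Union>i. X i)"
    then obtain i v where "(a, v) \<in> Z i"
      by (auto simp: Z)
    then have "(a, case_nat i v) \<in> W"
      by (auto simp: W_def)
    then show "a \<in> fst ` W"
      by force
  qed (force simp: W_def Z)
  ultimately show ?thesis
    unfolding analytic_def by blast
qed

text \<open>Countably many certificates, one for each member, are interleaved into a single sequence.\<close>

lemma analytic_INT:
  assumes "\<And>i::nat. analytic (X i)"
  shows "analytic (\<Inter>i. X i)"
proof -
  obtain Z where cl: "\<And>i. closed (Z i)" and Z: "\<And>i. X i = fst ` (Z i :: ((nat \<Rightarrow> bool) \<times> (nat \<Rightarrow> nat)) set)"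
    using assms unfolding analytic_def by metis
  define W where "W = (\<Inter>i. (\<lambda>p. (fst p, \<lambda>n. snd p (prod_encode (i, n)))) -` Z i)"
  have "continuous_on UNIV (\<lambda>p :: (nat \<Rightarrow> bool) \<times> (nat \<Rightarrow> nat). (fst p, \<lambda>n. snd p (prod_encode (i, n))))" for i
    by (intro continuous_intros continuous_on_product_then_coordinatewise)
  then have "closed W"
    unfolding W_def by (blast intro: closed_vimage cl)
  moreover have "(\<Inter>i. X i) = fst ` W"
  proof (intro equalityI subsetI)
    fix a assume "a \<in> (\<Inter>i. X i)"
    then have "\<forall>i. \<exists>v. (a, v) \<in> Z i"
      by (force simp: Z)
    then obtain v where "\<And>i. (a, v i) \<in> Z i"
      by metis
    then have "(a, \<lambda>k. v (fst (prod_decode k)) (snd (prod_decode k))) \<in> W"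
      by (auto simp: W_def)
    then show "a \<in> fst ` W"
      by force
  qed (force simp: W_def Z)
  ultimately show ?thesis
    unfolding analytic_def by blast
qed

instance bool :: second_countable_topology
proof
  show "\<exists>B :: bool set set. countable B \<and> open = generate_topology B"
    by (intro exI[of _ "range lessThan \<union> range greaterThan"]) (auto simp: open_bool_def)
qed

text \<open>
  The sets that are analytic together with their complements form a \<open>\<sigma>\<close>-algebra that contains the
  clopen subbasic sets.
\<close>

lemma borel_imp_analytic:
  assumes "X \<in> sets (borel :: (nat \<Rightarrow> bool) measure)"
  shows "analytic X"
proof -
  let ?G = "{{x :: nat \<Rightarrow> bool. x i \<in> A} |i A. True}"
  have "sets (\<Pi>\<^sub>M i\<in>(UNIV :: nat set). (borel :: bool measure)) = sigma_sets UNIV ?G"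
    unfolding sets_PiM_single by (simp add: sets_borel_eq_count_space)
  then have "sets (borel :: (nat \<Rightarrow> bool) measure) = sigma_sets UNIV ?G"
    by (simp add: sets_PiM_equal_borel)
  then have "X \<in> sigma_sets UNIV ?G"
    using assms by simp
  then have "analytic X \<and> analytic (- X)"
  proof (induction rule: sigma_sets.induct)
    case (Basic a)
    then obtain i A where a: "a = (\<lambda>x. x i) -` A"
      by auto
    have "closed ((\<lambda>x :: nat \<Rightarrow> bool. x i) -` B)" for B
      by (rule closed_vimage) (auto simp: closed_def open_discrete)
    then show ?case
      unfolding a vimage_Compl[symmetric] by (blast intro: analytic_closed)
  next
    case (Union a)
    then show ?case
      by (simp add: Compl_UN analytic_UN analytic_INT)
  qed (auto simp: analytic_closed Compl_eq_Diff_UNIV[symmetric])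
  then show ?thesis ..
qed

text \<open>
  A point of Baire space carries a set of naturals in the parities of its values and has room for
  further information, so that one closed subset of Baire space can code both the members of a Borel
  family and the certificates for their membership.
\<close>

definition odd_set :: "(nat \<Rightarrow> nat) \<Rightarrow> nat set" where
  "odd_set u = {i. odd (u i)}"

lemma borel_family_eq_odd_set_image:
  assumes "borel_family J"
  obtains Y where "closed Y" "J = odd_set ` Y"
proof -
  obtain Z :: "((nat \<Rightarrow> bool) \<times> (nat \<Rightarrow> nat)) set" where Z: "closed Z" "char_fun ` J = fst ` Z"
    using borel_imp_analytic assms unfolding borel_family_def analytic_def by blast
  define Y where "Y = (\<lambda>u. (\<lambda>i. odd (u i), \<lambda>i. u i div 2)) -` Z"
  have *: "continuous_on UNIV (\<lambda>u :: nat \<Rightarrow> nat. odd (u i))" "continuous_on UNIV (\<lambda>u :: nat \<Rightarrow> nat. u i div 2)" for i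
    by (intro continuous_on_compose2[OF _ continuous_on_product_coordinates, of UNIV];
        simp add: continuous_on_open_vimage open_discrete)+
  have "closed Y"
    unfolding Y_def by (rule closed_vimage[OF Z(1)]) (intro continuous_intros *)
  moreover have "J = odd_set ` Y"
  proof (intro equalityI subsetI)
    fix A assume "A \<in> J"
    then obtain v where "(char_fun A, v) \<in> Z"
      using Z(2) by (metis fst_conv imageE imageI prod.collapse)
    then have "(\<lambda>i. 2 * v i + of_bool (i \<in> A)) \<in> Y"
      by (simp add: Y_def char_fun_def)
    then show "A \<in> odd_set ` Y"
      by (rule rev_image_eqI) (auto simp: odd_set_def)
  next
    fix A assume "A \<in> odd_set ` Y"
    then have "char_fun A \<in> fst ` Z"
      by (force simp: Y_def odd_set_def char_fun_def)
    then have "char_fun A \<in> char_fun ` J"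
      using Z(2) by simp
    moreover have "inj char_fun"
      by (auto simp: char_fun_def inj_def fun_eq_iff)
    ultimately show "A \<in> J"
      by (simp add: inj_image_mem_iff)
  qed
  ultimately show ?thesis ..
qed

section \<open>Compactness in Baire space\<close>

text \<open>Closedness in Baire space in terms of finite initial segments.\<close>

lemma closed_prefix_limit:
  fixes Y :: "(nat \<Rightarrow> nat) set"
  assumes "closed Y" and approx: "\<And>m. \<exists>v\<in>Y. \<forall>i<m. v i = u i"
  shows "u \<in> Y"
proof -
  obtain V where V: "\<And>m. V m \<in> Y" "\<And>m i. i < m \<Longrightarrow> V m i = u i"
    using approx by metis
  have "((\<lambda>m. V m i) \<longlongrightarrow> u i) sequentially" for i
    using V(2) by (intro tendsto_eventually eventually_sequentiallyI[of "Suc i"]) auto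
  then have "limitin (product_topology (\<lambda>_. euclidean) UNIV) V u sequentially"
    by (simp add: limitin_componentwise)
  then have "(V \<longlongrightarrow> u) sequentially"
    by (simp add: euclidean_product_topology)
  then show ?thesis
    using Lim_in_closed_set[OF \<open>closed Y\<close>, of V sequentially u] V(1) by simp
qed

text \<open>
  Compactness of \<open>\<Prod>i. B i\<close>, in the form that also allows \<open>h k\<close> to be arbitrary beyond its first
  \<open>k\<close> values. The sets \<open>K m\<close> are the nested infinite index sets that agree on the first \<open>m\<close> values.
\<close>

lemma konig_limit:
  fixes h :: "nat \<Rightarrow> nat \<Rightarrow> 'a"
  assumes fin: "\<And>i. finite (B i)" and mem: "\<And>k i. i < k \<Longrightarrow> h k i \<in> B i"
  obtains g where "\<And>m. infinite {k. \<forall>i<m. h k i = g i}"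
proof -
  define K where "K = rec_nat UNIV (\<lambda>m S. {k \<in> S. h k m = (SOME a. infinite {k \<in> S. h k m = a})})"
  define g where "g m = (SOME a. infinite {k \<in> K m. h k m = a})" for m
  have K_Suc: "K (Suc m) = {k \<in> K m. h k m = g m}" and K_0: "K 0 = UNIV" for m
    by (simp_all add: K_def g_def)
  have inf: "infinite (K m)" for m
  proof (induction m)
    case (Suc m)
    have "infinite (K m - {..m})"
      using Suc.IH by (rule Diff_infinite_finite[OF finite_atMost])
    moreover have "\<forall>k \<in> K m - {..m}. \<exists>a \<in> B m. h k m = a"
      using mem by auto
    ultimately have "\<exists>a \<in> B m. infinite {k \<in> K m - {..m}. h k m = a}"
      by (intro pigeonhole_infinite_rel fin)
    then have "\<exists>a. infinite {k \<in> K m. h k m = a}"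
      by (auto elim!: infinite_super[rotated])
    then show ?case
      unfolding K_Suc g_def by (rule someI_ex)
  qed (simp add: K_0)
  have "K m = {k. \<forall>i<m. h k i = g i}" for m
    by (induction m) (auto simp: K_0 K_Suc less_Suc_eq)
  then show ?thesis
    using inf that by metis
qed

section \<open>The tree of finite sequences\<close>

text \<open>The ideals live on \<open>\<omega>\<close>, so the nodes of the tree are represented by their codes.\<close>

definition depth :: "nat \<Rightarrow> nat" where
  "depth x = length (list_decode x)"

definition node :: "(nat \<Rightarrow> nat) \<Rightarrow> nat \<Rightarrow> nat" where
  "node f l = list_encode (map f [0..<l])"

definition branch :: "(nat \<Rightarrow> nat) \<Rightarrow> nat set" where
  "branch f = range (node f)"

lemma depth_node [simp]: "depth (node f l) = l"
  by (simp add: depth_def node_def)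

lemma inj_node: "inj (node f)"
  by (metis depth_node injI)

lemma node_eq_iff: "node f l = node g k \<longleftrightarrow> l = k \<and> (\<forall>i<l. f i = g i)"
  by (metis (mono_tags, lifting) depth_node list_encode_eq map_eq_conv node_def atLeast_upt lessThan_iff)

lemma branch_eq: "x \<in> branch f \<longleftrightarrow> node f (depth x) = x"
  unfolding branch_def by (metis depth_node rangeE rangeI)

text \<open>Two nodes are comparable exactly when they lie on a common branch.\<close>

definition antichain :: "nat set \<Rightarrow> bool" where
  "antichain F \<longleftrightarrow> (\<forall>x\<in>F. \<forall>y\<in>F. x \<noteq> y \<longrightarrow> \<not> (\<exists>f. {x, y} \<subseteq> branch f))"

lemma antichain_subset: "antichain F \<Longrightarrow> G \<subseteq> F \<Longrightarrow> antichain G"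
  unfolding antichain_def by blast

text \<open>
  By Ramsey's theorem there is an infinite subset whose elements are pairwise incomparable or
  pairwise comparable. In the second case the elements have different depths, so they contain
  arbitrarily long sequences, and these agree with each other and define the branch.
\<close>

lemma infinite_branch_or_antichain:
  assumes "infinite X"
  obtains H where "H \<subseteq> X" "infinite H" "antichain H \<or> (\<exists>f. H \<subseteq> branch f)"
proof -
  define col :: "nat set \<Rightarrow> nat" where "col e = of_bool (\<exists>f. e \<subseteq> branch f)" for e
  have "\<forall>x\<in>X. \<forall>y\<in>X. x \<noteq> y \<longrightarrow> col {x, y} < 2"
    by (simp add: col_def)
  have "\<exists>H t. H \<subseteq> X \<and> infinite H \<and> t < 2 \<and> (\<forall>x\<in>H. \<forall>y\<in>H. x \<noteq> y \<longrightarrow> col {x, y} = t)"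
    using assms \<open>\<forall>x\<in>X. \<forall>y\<in>X. x \<noteq> y \<longrightarrow> col {x, y} < 2\<close> by (rule Ramsey2)
  then obtain H t where H: "H \<subseteq> X" "infinite H"
    and t: "\<forall>x\<in>H. \<forall>y\<in>H. x \<noteq> y \<longrightarrow> col {x, y} = t"
    by (elim exE conjE)
  show ?thesis
  proof (cases "t = 0")
    case True
    then have "antichain H"
      using t by (force simp: antichain_def col_def)
    then show ?thesis
      using H that by blast
  next
    case False
    then have common: "\<exists>f. x \<in> branch f \<and> y \<in> branch f" if "x \<in> H" "y \<in> H" "x \<noteq> y" for x y
      using bspec[OF bspec[OF t that(1)] that(2)] that(3) False by (auto simp: col_def)
    then have common: "\<exists>f. x \<in> branch f \<and> y \<in> branch f" if "x \<in> H" "y \<in> H" for x y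
    proof -
      have "infinite (H - {x})"
        using H(2) by simp
      then obtain z where "z \<in> H" "z \<noteq> x"
        by (metis infinite_imp_nonempty Diff_iff all_not_in_conv singletonI)
      then show ?thesis
        using common[of x z] common[of x y] that by blast
    qed
    have "inj_on depth H"
      using common by (metis branch_eq inj_onI)
    then have "infinite (depth ` H)"
      using H(2) by (simp add: finite_image_iff)
    then have "\<forall>i. \<exists>x\<in>H. i < depth x"
      by (metis finite_nat_set_iff_bounded_le imageE not_le)
    then obtain long where long: "\<And>i. long i \<in> H" "\<And>i. i < depth (long i)"
      by metis
    define f where "f i = list_decode (long i) ! i" for i
    have nth: "list_decode x ! i = g i" if "x \<in> branch g" "i < depth x" for x g i
      using that by (auto simp: branch_def node_def depth_def)
    have "x \<in> branch f" if x: "x \<in> H" for x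
    proof -
      have "f i = list_decode x ! i" if "i < depth x" for i
        using common[OF x long(1)[of i]] nth long(2) that unfolding f_def by metis
      moreover obtain g where "x \<in> branch g"
        using common x by blast
      ultimately have "node f (depth x) = node g (depth x)"
        using nth by (simp add: node_eq_iff)
      then show ?thesis
        using \<open>x \<in> branch g\<close> by (simp add: branch_eq)
    qed
    then show ?thesis
      using H that by blast
  qed
qed

section \<open>The diagonal ideal\<close>

definition covered :: "(nat set \<Rightarrow> bool) \<Rightarrow> nat \<Rightarrow> nat set \<Rightarrow> bool" where
  "covered P n F \<longleftrightarrow> (\<exists>c. (\<forall>x\<in>F. c x < n) \<and> (\<forall>i<n. P {x \<in> F. c x = i}))"

lemma covered_cong [fundef_cong]:
  assumes "F = F'" "n = n'" "\<And>H. H \<subseteq> F' \<Longrightarrow> P H = Q H"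
  shows "covered P n F = covered Q n' F'"
proof -
  have "P {x \<in> F'. c x = i} = Q {x \<in> F'. c x = i}" for c and i :: nat
    by (rule assms(3)) auto
  then show ?thesis
    by (simp add: covered_def assms(1,2))
qed

text \<open>
  The finite sets that generate the diagonal ideal: antichains, and subsets of a branch \<open>f\<close> that
  dominate a certificate \<open>(u, g)\<close> which passes the tests visible at this stage. The full certificate
  says that \<open>odd_set u\<close>, which is in the given Borel ideal because of \<open>u \<in> Y\<close>, has a preimage under
  \<open>f\<close> outside the diagonal ideal, since for each \<open>n\<close> its part below \<open>g n\<close> is not a union of \<open>n\<close> pieces.

  Domination is imposed on the element of \<open>F\<close> of rank \<open>j\<close> and all higher ones: their depths bound
  \<open>u j\<close> and \<open>g j\<close>. Quantifying over all \<open>j\<close> up to the rank makes the condition hereditary, since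
  ranks only drop when \<open>F\<close> shrinks.

  The test for \<open>n\<close> is postponed until \<open>card F\<close> exceeds \<open>g n\<close> and all values of \<open>f\<close> below \<open>g n\<close>. In
  the limit every test is made. At a finite stage a test mentions only sets of at most
  \<open>g n < card F\<close> elements, so the self-reference is a recursion on cardinality.
\<close>

function piece :: "(nat \<Rightarrow> nat) set \<Rightarrow> nat set \<Rightarrow> bool" where
  "piece Y F \<longleftrightarrow> finite F \<and> (antichain F \<or>
     (\<exists>f. F \<subseteq> branch f \<and> (\<exists>u\<in>Y. \<exists>g.
        (\<forall>x\<in>F. \<forall>j \<le> card {y \<in> F. depth y < depth x}. u j \<le> depth x \<and> g j \<le> depth x) \<and>
        (\<forall>n. g n < card F \<longrightarrow> (\<forall>p<g n. f p < card F) \<longrightarrow>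
           \<not> covered (piece Y) n (f -` odd_set u \<inter> {..<g n})))))"
  by pat_completeness auto
termination
proof (relation "Wellfounded.measure (\<lambda>(Y, F). card F)")
  fix F :: "nat set" and f u and g :: "nat \<Rightarrow> nat" and n :: nat and H
  assume "H \<subseteq> f -` odd_set u \<inter> {..<g n}" "g n < card F"
  then have "H \<subseteq> {..<g n}"
    by blast
  then have "card H \<le> g n"
    using card_mono[of "{..<g n}" H] by simp
  then show "((Y, H), (Y, F)) \<in> Wellfounded.measure (\<lambda>(Y, F). card F)" for Y :: "(nat \<Rightarrow> nat) set"
    using \<open>g n < card F\<close> by simp
qed simp

declare piece.simps [simp del]

text \<open>The clause of \<open>piece\<close> for subsets of branches, with its certificate made explicit.\<close>

definition certifies :: "(nat \<Rightarrow> nat) set \<Rightarrow> (nat \<Rightarrow> nat) \<Rightarrow> (nat \<Rightarrow> nat) \<Rightarrow> (nat \<Rightarrow> nat) \<Rightarrow> nat set \<Rightarrow> bool" where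
  "certifies Y f u g F \<longleftrightarrow> F \<subseteq> branch f \<and> u \<in> Y \<and>
     (\<forall>x\<in>F. \<forall>j \<le> card {y \<in> F. depth y < depth x}. u j \<le> depth x \<and> g j \<le> depth x) \<and>
     (\<forall>n. g n < card F \<longrightarrow> (\<forall>p<g n. f p < card F) \<longrightarrow>
        \<not> covered (piece Y) n (f -` odd_set u \<inter> {..<g n}))"

lemma piece_iff:
  "piece Y F \<longleftrightarrow> finite F \<and> (antichain F \<or> (\<exists>f u g. certifies Y f u g F))"
  unfolding certifies_def by (subst piece.simps) blast

lemma certifies_subset:
  assumes "certifies Y f u g F" "finite F" "G \<subseteq> F"
  shows "certifies Y f u g G"
proof -
  have rank: "card {y \<in> G. depth y < k} \<le> card {y \<in> F. depth y < k}" for k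
    using assms(2,3) by (intro card_mono) auto
  have "card G \<le> card F"
    using assms(2,3) by (simp add: card_mono)
  then have "\<not> covered (piece Y) n (f -` odd_set u \<inter> {..<g n})"
    if "g n < card G" "\<forall>p<g n. f p < card G" for n
    using assms(1) that unfolding certifies_def by (meson order_less_le_trans)
  moreover have "u j \<le> depth x \<and> g j \<le> depth x" if "x \<in> G" "j \<le> card {y \<in> G. depth y < depth x}" for x j
    using assms(1,3) that order_trans[OF that(2) rank] unfolding certifies_def by blast
  ultimately show ?thesis
    using assms(1,3) unfolding certifies_def by blast
qed

lemma piece_subset: "piece Y F \<Longrightarrow> G \<subseteq> F \<Longrightarrow> piece Y G"
  unfolding piece_iff by (meson antichain_subset certifies_subset finite_subset)

lemma covered_piece_subset:
  assumes "covered (piece Y) n F" "G \<subseteq> F"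
  shows "covered (piece Y) n G"
proof -
  obtain c where c: "\<forall>x\<in>F. c x < n" "\<forall>i<n. piece Y {x \<in> F. c x = i}"
    using assms(1) unfolding covered_def by blast
  have "piece Y {x \<in> G. c x = i}" if "i < n" for i
    using c(2) that assms(2) by (blast intro: piece_subset)
  then show ?thesis
    unfolding covered_def using c(1) assms(2) by blast
qed

lemma covered_piece_Un:
  assumes "covered (piece Y) n F" "covered (piece Y) m G"
  shows "covered (piece Y) (n + m) (F \<union> G)"
proof -
  obtain c where c: "\<forall>x\<in>F. c x < n" "\<forall>i<n. piece Y {x \<in> F. c x = i}"
    using assms(1) unfolding covered_def by blast
  obtain d where d: "\<forall>x\<in>G. d x < m" "\<forall>i<m. piece Y {x \<in> G. d x = i}"
    using assms(2) unfolding covered_def by blast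
  define e where "e x = (if x \<in> F then c x else n + d x)" for x
  have "piece Y {x \<in> F \<union> G. e x = i}" if i: "i < n + m" for i
  proof (cases "i < n")
    case True
    then have "{x \<in> F \<union> G. e x = i} \<subseteq> {x \<in> F. c x = i}"
      by (auto simp: e_def split: if_splits)
    then show ?thesis
      using True c(2) piece_subset by blast
  next
    case False
    then obtain j where j: "i = n + j" "j < m"
      using i by (metis add_less_cancel_left le_Suc_ex not_less)
    have "c x < n" if "x \<in> F" for x
      using c(1) that by blast
    then have "{x \<in> F \<union> G. e x = i} \<subseteq> {x \<in> G. d x = j}"
      unfolding e_def j(1) by (force split: if_splits)
    then show ?thesis
      using d(2) j(2) piece_subset by blast
  qed
  moreover have "\<forall>x\<in>F \<union> G. e x < n + m"
    using c(1) d(1) by (auto simp: e_def trans_less_add1)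
  ultimately show ?thesis
    unfolding covered_def by blast
qed

text \<open>
  Bounding the number of pieces uniformly over the finite subsets, instead of asking for a
  partition of \<open>B\<close> itself, makes the family visibly \<open>F\<^sub>\<sigma>\<close>.
\<close>

definition diag_ideal :: "(nat \<Rightarrow> nat) set \<Rightarrow> nat set set" where
  "diag_ideal Y = {B. \<exists>n. \<forall>F\<subseteq>B. finite F \<longrightarrow> covered (piece Y) n F}"

lemma diag_ideal_if_pieces:
  assumes "\<And>F. finite F \<Longrightarrow> F \<subseteq> B \<Longrightarrow> piece Y F"
  shows "B \<in> diag_ideal Y"
proof -
  have "covered (piece Y) 1 F" if "finite F" "F \<subseteq> B" for F
    unfolding covered_def using assms[OF that] by (intro exI[of _ "\<lambda>_. 0"]) simp
  then show ?thesis
    unfolding diag_ideal_def by blast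
qed

text \<open>Bounds on the number of pieces add up under unions, because pieces are hereditary.\<close>

lemma ideal_diag_ideal: "ideal_on_omega (diag_ideal Y)"
proof -
  have Un: "A \<union> B \<in> diag_ideal Y" if AB: "A \<in> diag_ideal Y" "B \<in> diag_ideal Y" for A B
  proof -
    obtain n m where n: "\<forall>F\<subseteq>A. finite F \<longrightarrow> covered (piece Y) n F"
      and m: "\<forall>F\<subseteq>B. finite F \<longrightarrow> covered (piece Y) m F"
      using AB unfolding diag_ideal_def by blast
    have "covered (piece Y) (n + m) F" if "finite F" "F \<subseteq> A \<union> B" for F
    proof -
      have "F = (F \<inter> A) \<union> (F \<inter> B)"
        using that by blast
      then show ?thesis
        using covered_piece_Un[of Y n "F \<inter> A" m "F \<inter> B"] n m that(1) by simp
    qed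
    then show ?thesis
      unfolding diag_ideal_def by blast
  qed
  have small: "piece Y F" if "F \<subseteq> {x}" for F x
  proof -
    have "finite F"
      using that by (rule finite_subset) simp
    moreover have "antichain F"
      using that by (auto simp: antichain_def)
    ultimately show ?thesis
      by (simp add: piece_iff)
  qed
  have single: "{x} \<in> diag_ideal Y" for x
    by (rule diag_ideal_if_pieces) (rule small)
  have fin: "A \<in> diag_ideal Y" if "finite A" for A
    using that
  proof (induction A)
    case empty
    show ?case
      by (rule diag_ideal_if_pieces) (auto intro: small)
  next
    case (insert x A)
    then show ?case
      using Un[OF single[of x]] by simp
  qed
  have down: "B \<in> diag_ideal Y" if AB: "A \<in> diag_ideal Y" "B \<subseteq> A" for A B
  proof -
    obtain n where n: "\<forall>F\<subseteq>A. finite F \<longrightarrow> covered (piece Y) n F"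
      using AB(1) unfolding diag_ideal_def by blast
    have "covered (piece Y) n F" if "F \<subseteq> B" "finite F" for F
      using n order_trans[OF that(1) AB(2)] that(2) by simp
    then show ?thesis
      unfolding diag_ideal_def by blast
  qed
  show ?thesis
    using down Un fin by (rule ideal_on_omegaI)
qed

text \<open>For fixed \<open>n\<close> and finite \<open>F\<close> the condition on \<open>B\<close> depends only on whether \<open>F \<subseteq> B\<close>.\<close>

lemma borel_diag_ideal: "borel_family (diag_ideal Y)"
proof -
  have "{x. {n. x n} \<in> diag_ideal Y}
    = (\<Union>n. \<Inter>F\<in>{F. finite F}. {x. F \<subseteq> {i. x i} \<longrightarrow> covered (piece Y) n F})"
    by (auto simp: diag_ideal_def)
  moreover have "{x :: nat \<Rightarrow> bool. F \<subseteq> {i. x i} \<longrightarrow> covered (piece Y) n F} \<in> sets borel" if "finite F" for F n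
  proof -
    have "{x :: nat \<Rightarrow> bool. \<forall>i\<in>F. x (id i) \<in> {True}} \<in> sets borel"
      by (intro borel_open product_topology_basis' that open_discrete)
    then have "- {x :: nat \<Rightarrow> bool. \<forall>i\<in>F. x i} \<in> sets borel"
      by (simp add: borel_comp)
    moreover have "{x :: nat \<Rightarrow> bool. F \<subseteq> {i. x i} \<longrightarrow> covered (piece Y) n F}
      = (if covered (piece Y) n F then UNIV else - {x :: nat \<Rightarrow> bool. \<forall>i\<in>F. x i})"
      by auto
    ultimately show ?thesis
      by simp
  qed
  then have "(\<Inter>F\<in>{F. finite F}. {x. F \<subseteq> {i. x i} \<longrightarrow> covered (piece Y) n F}) \<in> sets borel" for n
    by (intro sets.countable_INT'') (simp_all add: countable_Collect_finite)
  then have "(\<Union>n. \<Inter>F\<in>{F. finite F}. {x. F \<subseteq> {i. x i} \<longrightarrow> covered (piece Y) n F}) \<in> sets borel"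
    by (intro sets.countable_UN image_subsetI)
  ultimately show ?thesis
    by (simp only: borel_family_iff)
qed

text \<open>
  Initial segments suffice as the finite sets that refute membership, so a refutation is coded by
  a sequence of naturals.
\<close>

lemma not_in_diag_ideal_iff:
  "B \<notin> diag_ideal Y \<longleftrightarrow> (\<exists>g. \<forall>n. \<not> covered (piece Y) n (B \<inter> {..<g n}))"
proof
  assume "B \<notin> diag_ideal Y"
  then have "\<forall>n. \<exists>F. finite F \<and> F \<subseteq> B \<and> \<not> covered (piece Y) n F"
    by (auto simp: diag_ideal_def)
  moreover have "\<exists>k. F \<subseteq> {..<k}" if "finite F" for F :: "nat set"
    using that by (simp add: finite_nat_set_iff_bounded subset_eq)
  ultimately have "\<forall>n. \<exists>k. \<not> covered (piece Y) n (B \<inter> {..<k})"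
    by (meson covered_piece_subset Int_greatest)
  then show "\<exists>g. \<forall>n. \<not> covered (piece Y) n (B \<inter> {..<g n})"
    by metis
qed (auto simp: diag_ideal_def)

section \<open>Members of the diagonal ideal inside a branch\<close>

text \<open>
  Given a complete certificate for \<open>f\<close>, thin \<open>B\<close> until the depths of its elements outgrow the
  certificate. Then the same certificate serves all finite subsets.
\<close>

lemma diag_ideal_below_branch:
  assumes B: "infinite B" "B \<subseteq> branch f" and "u \<in> Y"
    and g: "\<And>n. \<not> covered (piece Y) n (f -` odd_set u \<inter> {..<g n})"
  shows "\<exists>B'\<subseteq>B. infinite B' \<and> B' \<in> diag_ideal Y"
proof -
  define b where "b k = (\<Sum>j\<le>k. u j + g j)" for k
  have b: "u j \<le> b k \<and> g j \<le> b k" if "j \<le> k" for j k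
    using member_le_sum[of j "{..k}" "\<lambda>j. u j + g j"] that by (simp add: b_def)
  have "inj_on depth B"
    using B(2) by (metis branch_eq inj_onI subsetD)
  then have "infinite (depth ` B)"
    using B(1) by (simp add: finite_image_iff)
  then have far: "\<exists>y\<in>depth ` B. k < y" for k
    by (metis finite_nat_set_iff_bounded_le not_le)
  \<comment> \<open>\<open>e k\<close> is the depth of the \<open>k\<close>-th element of the thinned set.\<close>
  have "\<exists>e. \<forall>k. (e k \<in> depth ` B \<and> b k \<le> e k) \<and> e k < e (Suc k)"
  proof (rule dependent_nat_choice)
    show "\<exists>x. x \<in> depth ` B \<and> b 0 \<le> x"
      using far[of "b 0"] by (auto intro: less_imp_le)
    show "\<exists>y. (y \<in> depth ` B \<and> b (Suc k) \<le> y) \<and> x < y" for x k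
      using far[of "max x (b (Suc k))"] by (auto intro: less_imp_le)
  qed
  then obtain e where e: "\<And>k. e k \<in> depth ` B" "\<And>k. b k \<le> e k" "strict_mono e"
    by (metis strict_mono_Suc_iff)
  define B' where "B' = range (\<lambda>k. node f (e k))"
  have "inj (\<lambda>k. node f (e k))"
    using inj_compose[OF inj_node strict_mono_imp_inj_on[OF e(3)]] by (simp add: comp_def)
  then have "infinite B'"
    unfolding B'_def by (rule range_inj_infinite)
  have "B' \<subseteq> B"
  proof -
    have "node f (e k) \<in> B" for k
      using e(1)[of k] B(2) branch_eq by fastforce
    then show ?thesis
      by (auto simp: B'_def)
  qed
  have "piece Y F" if F: "finite F" "F \<subseteq> B'" for F
  proof -
    have "u j \<le> depth x \<and> g j \<le> depth x" if x: "x \<in> F" and j: "j \<le> card {y \<in> F. depth y < depth x}" for x j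
    proof -
      obtain k where k: "x = node f (e k)"
        using x F(2) by (auto simp: B'_def)
      have "{y \<in> F. depth y < depth x} \<subseteq> (\<lambda>k. node f (e k)) ` {..<k}"
        using F(2) strict_mono_less[OF e(3)] by (auto simp: B'_def k)
      then have "j \<le> k"
        using j card_mono[OF finite_imageI[OF finite_lessThan]] card_image_le[OF finite_lessThan, of _ k]
        by (metis card_lessThan order_trans)
      then show ?thesis
        using b[of j k] e(2)[of k] by (simp add: k)
    qed
    then have "certifies Y f u g F"
      unfolding certifies_def using \<open>u \<in> Y\<close> g F(2) \<open>B' \<subseteq> B\<close> B(2) by blast
    then show ?thesis
      using F(1) by (auto simp: piece_iff)
  qed
  then have "B' \<in> diag_ideal Y"
    by (rule diag_ideal_if_pieces)
  then show ?thesis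
    using \<open>infinite B'\<close> \<open>B' \<subseteq> B\<close> by blast
qed

text \<open>
  The partitions of the initial segments of \<open>B\<close> into \<open>n\<close> pieces converge, along a subsequence, to a
  partition of \<open>B\<close>; one of its classes is infinite.
\<close>

lemma diag_ideal_imp_pieces:
  assumes "infinite B" "B \<in> diag_ideal Y"
  obtains B' where "B' \<subseteq> B" "infinite B'" "\<And>F. finite F \<Longrightarrow> F \<subseteq> B' \<Longrightarrow> piece Y F"
proof -
  obtain n where n: "\<And>F. F \<subseteq> B \<Longrightarrow> finite F \<Longrightarrow> covered (piece Y) n F"
    using assms(2) by (auto simp: diag_ideal_def)
  have "\<exists>c. (\<forall>x\<in>B \<inter> {..<k}. c x < n) \<and> (\<forall>i<n. piece Y {x \<in> B \<inter> {..<k}. c x = i})" for k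
  proof -
    have "covered (piece Y) n (B \<inter> {..<k})"
      by (rule n) auto
    then show ?thesis
      unfolding covered_def .
  qed
  then obtain c where c': "\<And>k. (\<forall>x\<in>B \<inter> {..<k}. c k x < n) \<and> (\<forall>i<n. piece Y {x \<in> B \<inter> {..<k}. c k x = i})"
    by metis
  have c: "x \<in> B \<Longrightarrow> x < k \<Longrightarrow> c k x < n" "i < n \<Longrightarrow> piece Y {x \<in> B \<inter> {..<k}. c k x = i}" for x k i
    using c'[of k] by auto
  define h where "h k x = (if x \<in> B then c k x else 0)" for k x
  have "h k x \<in> {..n}" if "x < k" for k x
    using c(1)[of x k] that by (auto simp: h_def)
  then obtain d where d: "\<And>m. infinite {k. \<forall>x<m. h k x = d x}"
    using konig_limit[of "\<lambda>_. {..n}" h] by blast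
  have stage: "\<exists>k\<ge>m. \<forall>x<m. x \<in> B \<longrightarrow> c k x = d x" for m
  proof -
    obtain k where "m \<le> k" "\<forall>x<m. h k x = d x"
      using d[of m] by (auto simp: infinite_nat_iff_unbounded_le)
    then show ?thesis
      by (metis h_def)
  qed
  have "\<forall>x\<in>B. \<exists>i\<in>{..<n}. d x = i"
  proof
    fix x assume "x \<in> B"
    then show "\<exists>i\<in>{..<n}. d x = i"
      using stage[of "Suc x"] c(1)[of x] by (metis Suc_le_lessD lessI lessThan_iff)
  qed
  with assms(1) have "\<exists>i\<in>{..<n}. infinite {x \<in> B. d x = i}"
    by (intro pigeonhole_infinite_rel) auto
  then obtain i where i: "i < n" "infinite {x \<in> B. d x = i}"
    by blast
  have "piece Y F" if F: "finite F" "F \<subseteq> {x \<in> B. d x = i}" for F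
  proof -
    obtain m where m: "F \<subseteq> {..<m}"
      using F(1) by (auto simp: finite_nat_set_iff_bounded)
    obtain k where "k \<ge> m" "\<forall>x<m. x \<in> B \<longrightarrow> c k x = d x"
      using stage by blast
    then have "F \<subseteq> {x \<in> B \<inter> {..<k}. c k x = i}"
      using F(2) m by fastforce
    then show ?thesis
      using c(2)[OF i(1)] piece_subset by blast
  qed
  then show ?thesis
    using i(2) that[of "{x \<in> B. d x = i}"] by blast
qed

text \<open>
  Inside \<open>B\<close> there is an infinite set, enumerated in order of depth by the nodes
  \<open>node f (e i)\<close>, all of whose finite subsets are pieces. Its initial segments are not antichains, so
  they have certificates. Domination bounds the values at \<open>i\<close> of these certificates by \<open>e i\<close>, and a
  limit of them exists by compactness. As \<open>Y\<close> is closed and each test depends on finitely many values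
  only, the limit is a complete certificate for \<open>f\<close>.
\<close>

lemma diag_ideal_branch_witness:
  assumes "closed Y" and B: "infinite B" "B \<subseteq> branch f" "B \<in> diag_ideal Y"
  obtains u g where "u \<in> Y" "\<And>n. \<not> covered (piece Y) n (f -` odd_set u \<inter> {..<g n})"
proof -
  obtain C where C: "C \<subseteq> B" "infinite C" "\<And>F. finite F \<Longrightarrow> F \<subseteq> C \<Longrightarrow> piece Y F"
    using diag_ideal_imp_pieces[OF B(1,3)] by blast
  have nodeC: "node f (depth x) = x" if "x \<in> C" for x
    using that C(1) B(2) branch_eq by blast
  have "inj_on depth C"
    by (metis nodeC inj_onI)
  then have "infinite (depth ` C)"
    using C(2) by (simp add: finite_image_iff)
  define e where "e = enumerate (depth ` C)"
  have e: "strict_mono e" "\<And>i. e i \<in> depth ` C" "\<And>i. i \<le> e i"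
    using \<open>infinite (depth ` C)\<close>
    by (simp_all add: e_def strict_mono_enumerate enumerate_in_set le_enumerate)
  \<comment> \<open>At least two nodes each, so that no segment is an antichain.\<close>
  define F where "F k = (\<lambda>i. node f (e i)) ` {..<k + 2}" for k
  have inj: "inj (\<lambda>i. node f (e i))"
    using inj_compose[OF inj_node strict_mono_imp_inj_on[OF e(1)]] by (simp add: comp_def)
  have cardF: "card (F k) = k + 2" for k
    unfolding F_def by (subst card_image) (auto intro: inj_on_subset[OF inj])
  have "node f (e i) \<in> C" for i
    using e(2)[of i] nodeC by auto
  then have "piece Y (F k)" for k
    by (intro C(3)) (auto simp: F_def)
  moreover have "\<not> antichain (F k)" for k
  proof -
    have "node f (e 0) \<in> F k" "node f (e 1) \<in> F k" "node f (e 0) \<noteq> node f (e 1)"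
      using inj_eq[OF inj, of 0 1] by (auto simp: F_def)
    then show ?thesis
      unfolding antichain_def branch_def by blast
  qed
  ultimately have "\<forall>k. \<exists>f' u g. certifies Y f' u g (F k)"
    by (simp add: piece_iff)
  then obtain fs us gs where cert: "\<And>k. certifies Y (fs k) (us k) (gs k) (F k)"
    by metis
  have rank: "card {y \<in> F k. depth y < e i} = i" if "i < k" for k i
  proof -
    have "{y \<in> F k. depth y < e i} = (\<lambda>i. node f (e i)) ` {..<i}"
      using that strict_mono_less[OF e(1)] by (auto simp: F_def)
    then show ?thesis
      by (simp add: card_image inj_on_subset[OF inj])
  qed
  have bound: "us k i \<le> e i \<and> gs k i \<le> e i" if "i < k" for k i
  proof -
    have "node f (e i) \<in> F k"
      using that by (auto simp: F_def)
    then have "\<forall>j \<le> card {y \<in> F k. depth y < depth (node f (e i))}.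
        us k j \<le> depth (node f (e i)) \<and> gs k j \<le> depth (node f (e i))"
      using cert[of k] unfolding certifies_def by blast
    then show ?thesis
      by (simp add: rank[OF that])
  qed
  \<comment> \<open>The branch that certifies the \<open>k\<close>-th segment passes through a node on \<open>f\<close> of depth at least \<open>k\<close>.\<close>
  have agree: "fs k p = f p" if "p < k" for k p
  proof -
    have "node f (e k) \<in> branch (fs k)"
      using cert[of k] unfolding certifies_def F_def by auto
    then have "node (fs k) (e k) = node f (e k)"
      by (simp add: branch_eq)
    then show ?thesis
      using that e(3)[of k] by (simp add: node_eq_iff)
  qed
  have "(us k i, gs k i) \<in> {..e i} \<times> {..e i}" if "i < k" for k i
    using bound[OF that] by simp
  then obtain ug where ug: "\<And>m. infinite {k. \<forall>i<m. (us k i, gs k i) = ug i}"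
    using konig_limit[of "\<lambda>i. {..e i} \<times> {..e i}" "\<lambda>k i. (us k i, gs k i)"] by blast
  define u g where "u = fst \<circ> ug" and "g = snd \<circ> ug"
  have stage: "\<exists>k\<ge>m. \<forall>i<m. us k i = u i \<and> gs k i = g i" for m
  proof -
    obtain k where "m \<le> k" "\<forall>i<m. (us k i, gs k i) = ug i"
      using ug[of m] by (auto simp: infinite_nat_iff_unbounded_le)
    then have "\<forall>i<m. us k i = u i \<and> gs k i = g i"
      unfolding u_def g_def by (metis comp_apply fst_conv snd_conv)
    then show ?thesis
      using \<open>m \<le> k\<close> by blast
  qed
  have "u \<in> Y"
  proof (rule closed_prefix_limit[OF \<open>closed Y\<close>])
    have "us k \<in> Y" for k
      using cert[of k] by (simp add: certifies_def)
    then show "\<exists>v\<in>Y. \<forall>i<m. v i = u i" for m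
      using stage[of m] by blast
  qed
  moreover have "\<not> covered (piece Y) n (f -` odd_set u \<inter> {..<g n})" for n
  proof -
    obtain m0 where m0: "f ` {..<g n} \<subseteq> {..<m0}"
      by (meson finite_imageI finite_lessThan finite_nat_iff_bounded)
    \<comment> \<open>At stage \<open>m\<close> the test for \<open>n\<close> is active and involves only values on which the limit is reached.\<close>
    define m where "m = Suc (max m0 (max n (g n)))"
    obtain k where k: "k \<ge> m" "\<And>i. i < m \<Longrightarrow> us k i = u i" "\<And>i. i < m \<Longrightarrow> gs k i = g i"
      using stage[of m] by blast
    have f_le: "f p < m" if "p < g n" for p
      using m0 that by (force simp: m_def)
    have "gs k n = g n"
      by (rule k(3)) (simp add: m_def)
    moreover have "g n < m"
      by (simp add: m_def)
    moreover have "fs k -` odd_set (us k) \<inter> {..<g n} = f -` odd_set u \<inter> {..<g n}"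
      using f_le k(1,2) agree \<open>g n < m\<close> by (auto simp: odd_set_def)
    moreover have "\<forall>p<g n. fs k p < card (F k)"
      using f_le k(1) agree \<open>g n < m\<close> by (fastforce simp: cardF)
    moreover have "gs k n < card (F k) \<longrightarrow> (\<forall>p<gs k n. fs k p < card (F k)) \<longrightarrow>
        \<not> covered (piece Y) n (fs k -` odd_set (us k) \<inter> {..<gs k n})"
      using cert[of k] by (simp add: certifies_def)
    ultimately show ?thesis
      using k(1) by (simp add: cardF)
  qed
  ultimately show ?thesis
    using that by blast
qed

section \<open>The diagonal argument\<close>

text \<open>
  A witness \<open>f\<close> would make the diagonal ideal tall, in particular on the branch \<open>f\<close>. But infinite
  members on that branch exist only if \<open>f\<close> is not a witness.
\<close>

lemma not_katetov_le_diag_ideal: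
  assumes "closed Y" "ideal_on_omega J" "tall J" "J = odd_set ` Y"
  shows "\<not> J \<le>\<^sub>K diag_ideal Y"
proof
  assume "J \<le>\<^sub>K diag_ideal Y"
  then obtain f where f: "\<forall>A\<in>J. f -` A \<in> diag_ideal Y"
    by (auto simp: katetov_le_def)
  have "tall (diag_ideal Y)"
    using tall_if_katetov_above_tall[OF assms(2,3) ideal_diag_ideal f] .
  moreover have "infinite (branch f)"
    unfolding branch_def using inj_node by (rule range_inj_infinite)
  ultimately obtain B where "infinite B" "B \<subseteq> branch f" "B \<in> diag_ideal Y"
    unfolding tall_def by blast
  then obtain u g where "u \<in> Y" "\<And>n. \<not> covered (piece Y) n (f -` odd_set u \<inter> {..<g n})"
    using diag_ideal_branch_witness[OF assms(1)] by blast
  then have "f -` odd_set u \<notin> diag_ideal Y"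
    by (auto simp: not_in_diag_ideal_iff)
  then show False
    using f \<open>u \<in> Y\<close> assms(4) by blast
qed

text \<open>
  Each \<open>f\<close> fails to witness the reduction, and this failure provides the certificate that puts
  infinite subsets of the branch \<open>f\<close> into the ideal.
\<close>

lemma tall_diag_ideal:
  assumes "\<not> odd_set ` Y \<le>\<^sub>K diag_ideal Y"
  shows "tall (diag_ideal Y)"
  unfolding tall_def
proof (intro allI impI)
  fix X :: "nat set"
  assume "infinite X"
  then obtain H where H: "H \<subseteq> X" "infinite H" "antichain H \<or> (\<exists>f. H \<subseteq> branch f)"
    by (rule infinite_branch_or_antichain)
  from H(3) show "\<exists>B\<in>diag_ideal Y. infinite B \<and> B \<subseteq> X"
  proof
    assume "antichain H"
    then have "H \<in> diag_ideal Y"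
      by (intro diag_ideal_if_pieces) (auto simp: piece_iff intro: antichain_subset)
    then show ?thesis
      using H(1,2) by blast
  next
    assume "\<exists>f. H \<subseteq> branch f"
    then obtain f where f: "H \<subseteq> branch f" ..
    obtain u where "u \<in> Y" "f -` odd_set u \<notin> diag_ideal Y"
      using assms by (auto simp: katetov_le_def)
    then obtain g where "\<And>n. \<not> covered (piece Y) n (f -` odd_set u \<inter> {..<g n})"
      by (auto simp: not_in_diag_ideal_iff)
    from diag_ideal_below_branch[where g = g, OF H(2) f \<open>u \<in> Y\<close> this] show ?thesis
      using H(1) by blast
  qed
qed

theorem theorem3:
  shows "\<not> (\<exists>\<J>. minimal_tall_borel_ideal \<J>)"
proof
  assume "\<exists>\<J>. minimal_tall_borel_ideal \<J>"
  then obtain J where J: "tall_borel_ideal J"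
    and minimal: "\<And>I. tall_borel_ideal I \<Longrightarrow> I \<le>\<^sub>K J \<Longrightarrow> J \<le>\<^sub>K I"
    unfolding minimal_tall_borel_ideal_def by blast
  then obtain Y where Y: "closed Y" "J = odd_set ` Y"
    using borel_family_eq_odd_set_image unfolding tall_borel_ideal_def by blast
  have not_le: "\<not> J \<le>\<^sub>K diag_ideal Y"
    using J Y by (intro not_katetov_le_diag_ideal) (auto simp: tall_borel_ideal_def)
  then have "tall_borel_ideal (diag_ideal Y)"
    using Y(2) by (simp add: tall_borel_ideal_def ideal_diag_ideal borel_diag_ideal tall_diag_ideal)
  \<comment> \<open>The sum is below \<open>J\<close>, so minimality puts \<open>J\<close> below the sum, hence below its second summand.\<close>
  then have "J \<le>\<^sub>K ideal_sum J (diag_ideal Y)"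
    by (intro minimal tall_borel_ideal_sum J katetov_le_ideal_sum)
  then show False
    using katetov_le_trans katetov_le_ideal_sum(2) not_le by blast
qed

end
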